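(* Let $F$ be an unsatisfiable hitting clause-set and $F'\subseteq F$ a nonempty subset, and let $F'':=(F\setminus F')\cup\{\bigcap F'\}$. The following are equivalent: (1) $F'$ is a clause-factor of $F$; (2) $F''$ is a hitting clause-set (i.e., $\bigcap F'$ clashes with every clause in $F\setminus F'$); (3) $F''$ is an unsatisfiable hitting clause-set.
   Context: Literals are nonzero integers, the complement of $x$ is $\overline{x}=-x$. A clause is a finite set of literals with no pair $x,\overline{x}$; a clause-set is a finite set of clauses. $F$ is satisfiable if some clause meets every clause of $F$, otherwise unsatisfiable. $F$ is hitting if any two distinct clauses $C,D\in F$ clash, i.e., have some $x\in C$ with $\overline{x}\in D$. A nonempty clause-set $F'$ is a clause-factor if $\{D\setminus\bigcap F':D\in F'\}$ is unsatisfiable; a clause-factor of $F$ is a subset of $F$ which is a clause-factor. *)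

theory Defs
  imports Main
begin

type_synonym lit_set = "int set"

definition is_clause :: "lit_set \<Rightarrow> bool" where
  "is_clause C \<longleftrightarrow> finite C \<and> 0 \<notin> C \<and> (\<forall>x\<in>C. - x \<notin> C)"

definition clause_set :: "lit_set set \<Rightarrow> bool" where
  "clause_set F \<longleftrightarrow> finite F \<and> (\<forall>C\<in>F. is_clause C)"

text \<open>The satisfying clause \<open>C\<close> is read as the partial assignment making all its literals true.\<close>

definition satisfiable :: "lit_set set \<Rightarrow> bool" where
  "satisfiable F \<longleftrightarrow> (\<exists>C. is_clause C \<and> (\<forall>D\<in>F. C \<inter> D \<noteq> {}))"

definition clash :: "lit_set \<Rightarrow> lit_set \<Rightarrow> bool" where
  "clash C D \<longleftrightarrow> (\<exists>x\<in>C. - x \<in> D)"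

definition hitting_clause_set :: "lit_set set \<Rightarrow> bool" where
  "hitting_clause_set F \<longleftrightarrow> clause_set F \<and> (\<forall>C\<in>F. \<forall>D\<in>F. C \<noteq> D \<longrightarrow> clash C D)"

definition clause_factor :: "lit_set set \<Rightarrow> bool" where
  "clause_factor F' \<longleftrightarrow>
     clause_set F' \<and> F' \<noteq> {} \<and> \<not> satisfiable {D - \<Inter>F' | D. D \<in> F'}"

definition clause_factor_of :: "lit_set set \<Rightarrow> lit_set set \<Rightarrow> bool" where
  "clause_factor_of F' F \<longleftrightarrow> F' \<subseteq> F \<and> clause_factor F'"

end

theory Submission
  imports Defs
begin

text \<open>
  Write \<open>I = \<Inter>F'\<close>. If some \<open>D \<in> F - F'\<close> does not clash with \<open>I\<close>, then the literals by which \<open>D\<close>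
  clashes with the clauses of \<open>F'\<close> all lie outside \<open>I\<close>, so the assignment falsifying \<open>D\<close> satisfies
  all the \<open>C - I\<close> with \<open>C \<in> F'\<close>. Conversely, if \<open>I\<close> clashes with every clause of \<open>F - F'\<close>, then an
  assignment satisfying all the \<open>C - I\<close>, modified so as to falsify \<open>I\<close>, would satisfy \<open>F\<close>.
\<close>

lemma is_clause_subset: "is_clause C \<Longrightarrow> D \<subseteq> C \<Longrightarrow> is_clause D"
  unfolding is_clause_def by (auto intro: finite_subset)

lemma is_clause_uminus: "is_clause C \<Longrightarrow> is_clause (uminus ` C)"
  unfolding is_clause_def by auto

lemma clash_sym: "clash C D \<longleftrightarrow> clash D C"
  unfolding clash_def by (metis minus_minus)

text \<open>A clash would put a complementary pair into \<open>D\<close>. This serves to keep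
  \<open>\<Inter>F'\<close> from coinciding with a clause of \<open>F - F'\<close>.\<close>

lemma not_clash_subset:
  assumes "is_clause D" "C \<subseteq> D"
  shows "\<not> clash C D"
  using assms unfolding is_clause_def clash_def by blast

lemma hitting_clause_set_insert:
  "hitting_clause_set (insert C F) \<longleftrightarrow>
    is_clause C \<and> hitting_clause_set F \<and> (\<forall>D\<in>F. D \<noteq> C \<longrightarrow> clash C D)"
proof -
  have "(\<forall>D\<in>F. D \<noteq> C \<longrightarrow> clash D C) \<longleftrightarrow> (\<forall>D\<in>F. D \<noteq> C \<longrightarrow> clash C D)"
    using clash_sym by metis
  moreover have "(\<forall>D\<in>F. C \<noteq> D \<longrightarrow> clash C D) \<longleftrightarrow> (\<forall>D\<in>F. D \<noteq> C \<longrightarrow> clash C D)"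
    by metis
  ultimately show ?thesis
    unfolding hitting_clause_set_def clause_set_def ball_simps ball_conj_distrib finite_insert
    by argo
qed

lemma hitting_clause_set_subset: "hitting_clause_set F \<Longrightarrow> G \<subseteq> F \<Longrightarrow> hitting_clause_set G"
  unfolding hitting_clause_set_def clause_set_def
  by (intro conjI ballI impI; elim conjE) (simp_all add: finite_subset subset_iff)

text \<open>Every clause of \<open>F'\<close> contains \<open>\<Inter>F'\<close>, so meeting the
  intersection means meeting them all.\<close>

lemma satisfiable_replace_Inter:
  assumes "satisfiable ((F - F') \<union> {\<Inter>F'})"
  shows "satisfiable F"
proof -
  obtain A where A: "is_clause A" "\<forall>D\<in>F - F'. A \<inter> D \<noteq> {}" "A \<inter> \<Inter>F' \<noteq> {}"
    using assms unfolding satisfiable_def by auto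
  then have "\<forall>D\<in>F. A \<inter> D \<noteq> {}" by blast
  with A(1) show ?thesis unfolding satisfiable_def by blast
qed

lemma satisfiable_Diff_if_not_clash:
  assumes "is_clause D" "\<forall>C\<in>G. clash C D" "\<not> clash I D"
  shows "satisfiable {C - I | C. C \<in> G}"
proof -
  have "uminus ` D \<inter> (C - I) \<noteq> {}" if C: "C \<in> G" for C
  proof -
    obtain x where "x \<in> C" "- x \<in> D"
      using assms(2) C unfolding clash_def by blast
    \<comment> \<open>Otherwise \<open>x\<close> itself would witness a clash of \<open>I\<close>
      with \<open>D\<close>.\<close>
    moreover have "x \<notin> I"
      using assms(3) \<open>- x \<in> D\<close> unfolding clash_def by blast
    moreover have "x \<in> uminus ` D"
      using \<open>- x \<in> D\<close> by (metis imageI minus_minus)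
    ultimately show ?thesis by blast
  qed
  then show ?thesis
    using is_clause_uminus[OF assms(1)] unfolding satisfiable_def by blast
qed

lemma satisfiable_if_clash:
  assumes I: "is_clause I"
    and cl: "\<forall>D\<in>F - G. clash I D"
    and sat: "satisfiable {C - I | C. C \<in> G}"
  shows "satisfiable F"
proof -
  obtain A where A: "is_clause A" "\<forall>D\<in>{C - I | C. C \<in> G}. A \<inter> D \<noteq> {}"
    using sat unfolding satisfiable_def by (elim exE conjE)
  \<comment> \<open>\<open>B\<close> is \<open>A\<close> overwritten on the variables of
    \<open>I\<close>. Clauses of \<open>G\<close> are already met outside \<open>I\<close>, where
    nothing of \<open>A\<close> is lost; the other clauses of \<open>F\<close> contain the
    complement of a literal of \<open>I\<close>.\<close>
  define B where "B = (A - I) \<union> uminus ` I"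
  have mem_B: "x \<in> B \<longleftrightarrow> x \<in> A \<and> x \<notin> I \<or> - x \<in> I" for x
    unfolding B_def by (auto intro: rev_image_eqI)
  have "- x \<notin> B" if "x \<in> B" for x
    using that A(1) I unfolding mem_B is_clause_def by (metis minus_minus)
  moreover have "finite B" "0 \<notin> B"
    using A(1) I unfolding B_def is_clause_def by auto
  ultimately have "is_clause B"
    unfolding is_clause_def by blast
  moreover have "B \<inter> D \<noteq> {}" if D: "D \<in> F" for D
  proof (cases "D \<in> G")
    case True
    then have "A \<inter> (D - I) \<noteq> {}" using A(2) by auto
    then show ?thesis unfolding B_def by auto
  next
    case False
    then obtain x where "x \<in> I" "- x \<in> D"
      using cl D unfolding clash_def by blast
    then show ?thesis unfolding B_def by auto
  qed
  ultimately show ?thesis unfolding satisfiable_def by blast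
qed

theorem lemma13:
  fixes F F' F'' :: "int set set"
  assumes "hitting_clause_set F" and "\<not> satisfiable F"
    and "F' \<subseteq> F" and "F' \<noteq> {}"
    and "F'' = (F - F') \<union> {\<Inter>F'}"
  shows "(clause_factor_of F' F \<longleftrightarrow> hitting_clause_set F'') \<and>
    (hitting_clause_set F'' \<longleftrightarrow> (\<forall>D \<in> F - F'. clash (\<Inter>F') D)) \<and>
    (hitting_clause_set F'' \<longleftrightarrow> hitting_clause_set F'' \<and> \<not> satisfiable F'')"
proof -
  have clauses: "\<forall>C\<in>F. is_clause C" and hit: "\<forall>C\<in>F. \<forall>D\<in>F. C \<noteq> D \<longrightarrow> clash C D"
    using assms(1) unfolding hitting_clause_set_def clause_set_def by auto
  \<comment> \<open>The intersection of an empty family would be \<open>UNIV\<close>; as a subset of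
    \<open>C0\<close>, \<open>\<Inter>F'\<close> is finite and free of complementary pairs.\<close>
  obtain C0 where C0: "C0 \<in> F'" using assms(4) by blast
  have Inter_clause: "is_clause (\<Inter>F')"
    using is_clause_subset[OF _ Inter_lower[OF C0]] C0 clauses assms(3) by (metis subsetD)
  \<comment> \<open>The hitting condition compares distinct clauses only, whereas the claim asks for
    a clash with every \<open>D \<in> F - F'\<close>. So the case \<open>D = \<Inter>F'\<close> must
    be excluded.\<close>
  have Inter_notin: "\<Inter>F' \<notin> F - F'"
  proof
    assume "\<Inter>F' \<in> F - F'"
    then have "clash (\<Inter>F') C0" using hit C0 assms(3) by (metis DiffE subsetD)
    moreover have "is_clause C0" using clauses C0 assms(3) by (metis subsetD)
    ultimately show False
      using not_clash_subset[OF _ Inter_lower[OF C0]] by metis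
  qed
  have "F'' = insert (\<Inter>F') (F - F')" using assms(5) by simp
  moreover have "hitting_clause_set (F - F')"
    using hitting_clause_set_subset[OF assms(1) Diff_subset] .
  ultimately have hitting_iff:
    "hitting_clause_set F'' \<longleftrightarrow> (\<forall>D \<in> F - F'. clash (\<Inter>F') D)"
    using hitting_clause_set_insert[of "\<Inter>F'" "F - F'"] Inter_clause Inter_notin by metis
  \<comment> \<open>This holds whether or not \<open>F''\<close> is hitting, so conditions (2) and
    (3) agree.\<close>
  have F''_unsat: "\<not> satisfiable F''"
    using satisfiable_replace_Inter assms(2) unfolding assms(5) by (rule contrapos_nn[rotated])
  have F'_clauses: "clause_set F'"
    using hitting_clause_set_subset[OF assms(1,3)] unfolding hitting_clause_set_def by blast
  have "clause_factor_of F' F \<longleftrightarrow> \<not> satisfiable {C - \<Inter>F' | C. C \<in> F'}"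
    using F'_clauses assms(3,4) unfolding clause_factor_of_def clause_factor_def by blast
  also have "\<dots> \<longleftrightarrow> (\<forall>D \<in> F - F'. clash (\<Inter>F') D)"
  proof
    assume unsat: "\<not> satisfiable {C - \<Inter>F' | C. C \<in> F'}"
    show "\<forall>D \<in> F - F'. clash (\<Inter>F') D"
    proof
      fix D assume D: "D \<in> F - F'"
      have "is_clause D" using D clauses by simp
      moreover have "\<forall>C\<in>F'. clash C D"
      proof
        fix C assume C: "C \<in> F'"
        with D have "C \<noteq> D" by auto
        then show "clash C D" using C D hit assms(3) by (meson DiffD1 subsetD)
      qed
      ultimately show "clash (\<Inter>F') D"
        using satisfiable_Diff_if_not_clash[of D F' "\<Inter>F'"] unsat by argo
    qed
  next
    assume "\<forall>D \<in> F - F'. clash (\<Inter>F') D"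
    then show "\<not> satisfiable {C - \<Inter>F' | C. C \<in> F'}"
      using satisfiable_if_clash[of "\<Inter>F'" F F'] Inter_clause assms(2) by argo
  qed
  finally show ?thesis
    using hitting_iff F''_unsat by argo
qed

end
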